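(* Let $G$ be a 3-regular graph, and let $G'=(V',E')$ be the graph obtained from $G$ by adding one new vertex in the middle of each edge of $G$ (i.e., subdividing each edge once). Let $\mathbf{x}^*\in\mathbb{R}^{E'}$ be given by $x^*_e=1$ for each edge $e\in E'$. Then $\mathbf{x}^*$ lies in the GTSP polytope of $G'$ if and only if $G$ is Hamiltonian.
   Context: For a graph $H=(W,F)$, a GTSP tour of $H$ is a vector $\boldsymbol{\chi}\in\mathbb{Z}_{\ge 0}^{F}$ such that for every vertex $v\in W$ the sum $\sum_{e\in\delta(v)}\chi_e$ is positive and even, and for every nonempty proper subset $S\subset W$, $\sum_{e\in\delta(S)}\chi_e\ge 2$, where $\delta(v)$ is the set of edges incident to $v$ and $\delta(S)$ the set of edges with exactly one endpoint in $S$. The GTSP polytope of $H$ is the convex hull of all GTSP tours of $H$. $G$ is Hamiltonian if it has a cycle visiting every vertex exactly once. *)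

theory Defs
  imports "HOL-Analysis.Analysis" "HOL-Analysis.Finite_Function_Topology"
begin

text \<open>
  Graphs are finite, undirected and simple, with at least one vertex. An edge is the set of
  its two endpoints.
\<close>

definition simple_graph :: "'v set \<Rightarrow> 'v set set \<Rightarrow> bool" where
  "simple_graph W F \<longleftrightarrow> finite W \<and> W \<noteq> {} \<and> (\<forall>e\<in>F. e \<subseteq> W \<and> card e = 2)"

definition incident_edges :: "'v set set \<Rightarrow> 'v \<Rightarrow> 'v set set" where
  "incident_edges F v = {e \<in> F. v \<in> e}"

definition cut_edges :: "'v set set \<Rightarrow> 'v set \<Rightarrow> 'v set set" where
  "cut_edges F S = {e \<in> F. card (e \<inter> S) = 1}"

definition regular_graph :: "nat \<Rightarrow> 'v set \<Rightarrow> 'v set set \<Rightarrow> bool" where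
  "regular_graph k W F \<longleftrightarrow> simple_graph W F \<and> (\<forall>v\<in>W. card (incident_edges F v) = k)"

text \<open>A cycle is given by the list of its vertices in cyclic order.\<close>

definition graph_cycle :: "'v set \<Rightarrow> 'v set set \<Rightarrow> 'v list \<Rightarrow> bool" where
  "graph_cycle W F vs \<longleftrightarrow> 3 \<le> length vs \<and> distinct vs \<and> set vs \<subseteq> W \<and>
     (\<forall>i<length vs. {vs ! i, vs ! (Suc i mod length vs)} \<in> F)"

definition hamiltonian :: "'v set \<Rightarrow> 'v set set \<Rightarrow> bool" where
  "hamiltonian W F \<longleftrightarrow> (\<exists>vs. graph_cycle W F vs \<and> (\<forall>v\<in>W. count_list vs v = 1))"

text \<open>
  Subdividing each edge once: \<open>Inl v\<close> is the original vertex \<open>v\<close> and \<open>Inr e\<close> is the new vertex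
  in the middle of \<open>e\<close>.
\<close>

definition subdivision_verts :: "'v set \<Rightarrow> 'v set set \<Rightarrow> ('v + 'v set) set" where
  "subdivision_verts W F = Inl ` W \<union> Inr ` F"

definition subdivision_edges :: "'v set set \<Rightarrow> ('v + 'v set) set set" where
  "subdivision_edges F = {{Inl v, Inr e} | v e. e \<in> F \<and> v \<in> e}"

text \<open>
  For finite \<open>F\<close>, the space of real vectors indexed by \<open>F\<close> is represented by the finitely
  supported functions that vanish outside \<open>F\<close>.
\<close>

definition edge_vectors :: "'v set set \<Rightarrow> ('v set \<Rightarrow>\<^sub>0 real) set" where
  "edge_vectors F = {x. Poly_Mapping.keys x \<subseteq> F}"

text \<open>
  Tours are integral vectors inside the real vector space, so that their convex hull can be taken;
  parity of a degree is stated as equality with twice a natural number.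
\<close>

definition gtsp_tour :: "'v set \<Rightarrow> 'v set set \<Rightarrow> ('v set \<Rightarrow>\<^sub>0 real) \<Rightarrow> bool" where
  "gtsp_tour W F t \<longleftrightarrow>
     t \<in> edge_vectors F \<and>
     (\<forall>e\<in>F. Poly_Mapping.lookup t e \<in> \<nat>) \<and>
     (\<forall>v\<in>W. (\<Sum>e\<in>incident_edges F v. Poly_Mapping.lookup t e) > 0 \<and>
        (\<exists>k::nat. (\<Sum>e\<in>incident_edges F v. Poly_Mapping.lookup t e) = 2 * real k)) \<and>
     (\<forall>S. S \<noteq> {} \<and> S \<subset> W \<longrightarrow> (\<Sum>e\<in>cut_edges F S. Poly_Mapping.lookup t e) \<ge> 2)"

definition gtsp_polytope :: "'v set \<Rightarrow> 'v set set \<Rightarrow> ('v set \<Rightarrow>\<^sub>0 real) set" where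
  "gtsp_polytope W F = convex hull {t. gtsp_tour W F t}"

end

theory Submission
  imports Defs
begin

text \<open>
  In the all-ones vector every subdivision vertex has degree 2, the least degree a tour allows, so
  every tour in a convex combination giving it also has degree 2 there: each edge of \<open>G\<close> carries
  \<open>(1, 1)\<close>, \<open>(2, 0)\<close> or \<open>(0, 2)\<close> on its two halves. The edges of type \<open>(1, 1)\<close> have even degree at
  every vertex and must connect \<open>V\<close> on their own; as \<open>G\<close> is cubic, they form a Hamiltonian cycle.
  Conversely, a Hamiltonian cycle with every other edge doubled on one half is a tour, and
  exchanging all the doubled halves gives a second tour whose average with the first is all-ones.
\<close>

section \<open>Degree sums and cuts in simple graphs\<close>

lemma simple_graph_finite_edges:
  assumes "simple_graph W F"
  shows "finite F"
proof -
  have "F \<subseteq> Pow W"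
    using assms by (auto simp: simple_graph_def)
  then show ?thesis
    using assms by (meson finite_Pow_iff finite_subset simple_graph_def)
qed

lemma real_card_filter:
  assumes "finite A"
  shows "real (card {x \<in> A. P x}) = (\<Sum>x\<in>A. if P x then 1 else 0)"
proof -
  have "real (card {x \<in> A. P x}) = (\<Sum>x\<in>{x \<in> A. P x}. 1)"
    by simp
  also have "\<dots> = (\<Sum>x\<in>A. if P x then 1 else 0)"
    using assms by (rule sum.inter_filter)
  finally show ?thesis .
qed

text \<open>Double counting: on the left an edge is counted \<open>card (e \<inter> S)\<close>
  times, which is 1 for an edge of the cut, 2 for an edge inside \<open>S\<close> and 0 otherwise.
  This handshake identity for a vertex set passes parity from degrees to cuts.\<close>

lemma sum_degrees_eq:
  fixes f :: "'v set \<Rightarrow> real"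
  assumes "simple_graph W F" "S \<subseteq> W"
  shows "(\<Sum>v\<in>S. \<Sum>e\<in>incident_edges F v. f e)
    = (\<Sum>e\<in>cut_edges F S. f e) + 2 * (\<Sum>e\<in>{e\<in>F. e \<subseteq> S}. f e)"
proof -
  have fin: "finite F" "finite S"
    using assms simple_graph_finite_edges[OF assms(1)] finite_subset
    unfolding simple_graph_def by blast+
  have card_cases: "real (card (e \<inter> S)) =
      (if card (e \<inter> S) = 1 then 1 else 0) + 2 * (if e \<subseteq> S then 1 else 0)" if "e \<in> F" for e
  proof -
    have e: "card e = 2" "finite e"
      using that assms(1) card.infinite by (fastforce simp: simple_graph_def)+
    have "card (e \<inter> S) \<le> 2"
      using e card_mono[of e "e \<inter> S"] by simp
    moreover have "card (e \<inter> S) = 2 \<longleftrightarrow> e \<subseteq> S"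
      using e by (metis Int_absorb2 card_subset_eq inf.orderI inf_le1 inf_commute)
    ultimately show ?thesis
      by auto
  qed
  have "(\<Sum>v\<in>S. \<Sum>e\<in>incident_edges F v. f e) = (\<Sum>v\<in>S. \<Sum>e\<in>F. if v \<in> e then f e else 0)"
    using fin by (simp add: incident_edges_def sum.inter_filter)
  also have "\<dots> = (\<Sum>e\<in>F. \<Sum>v\<in>S. if v \<in> e then f e else 0)"
    by (rule sum.swap)
  also have "\<dots> = (\<Sum>e\<in>F. real (card (e \<inter> S)) * f e)"
    using fin by (intro sum.cong) (auto simp: Int_def conj_commute simp flip: sum.inter_filter)
  also have "\<dots> = (\<Sum>e\<in>F. (if card (e \<inter> S) = 1 then f e else 0)
      + 2 * (if e \<subseteq> S then f e else 0))"
    by (intro sum.cong) (auto simp: card_cases)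
  also have "\<dots> = (\<Sum>e\<in>cut_edges F S. f e) + 2 * (\<Sum>e\<in>{e\<in>F. e \<subseteq> S}. f e)"
    using fin by (simp add: sum.distrib cut_edges_def sum.inter_filter flip: sum_distrib_left)
  finally show ?thesis .
qed

text \<open>Cut weights inherit evenness from the degrees, so a positive cut weight is at least 2.\<close>

lemma gtsp_tourI:
  assumes G: "simple_graph W F" and t: "t \<in> edge_vectors F"
    and nat: "\<And>e. e \<in> F \<Longrightarrow> Poly_Mapping.lookup t e \<in> \<nat>"
    and pos: "\<And>v. v \<in> W \<Longrightarrow> (\<Sum>e\<in>incident_edges F v. Poly_Mapping.lookup t e) > 0"
    and even: "\<And>v. v \<in> W \<Longrightarrow>
      \<exists>k::nat. (\<Sum>e\<in>incident_edges F v. Poly_Mapping.lookup t e) = 2 * real k"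
    and cut: "\<And>S. S \<noteq> {} \<Longrightarrow> S \<subset> W \<Longrightarrow> \<exists>e\<in>cut_edges F S. Poly_Mapping.lookup t e > 0"
  shows "gtsp_tour W F t"
proof -
  let ?l = "Poly_Mapping.lookup t"
  have "(\<Sum>e\<in>cut_edges F S. ?l e) \<ge> 2" if S: "S \<noteq> {}" "S \<subset> W" for S
  proof -
    have fin: "finite (cut_edges F S)"
      using simple_graph_finite_edges[OF G] by (simp add: cut_edges_def)
    have nonneg: "?l e \<ge> 0" if "e \<in> F" for e
      using nat[OF that] by (auto simp: Nats_def)
    obtain k where k: "\<And>v. v \<in> W \<Longrightarrow> (\<Sum>e\<in>incident_edges F v. ?l e) = 2 * real (k v)"
      using even by metis
    \<comment> \<open>The weights as natural numbers, so that the weight inside \<open>S\<close>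
      becomes a natural number \<open>m\<close>.\<close>
    define g where "g e = nat \<lfloor>?l e\<rfloor>" for e
    have g: "?l e = real (g e)" if "e \<in> F" for e
      using nat[OF that] by (auto simp: Nats_def g_def)
    define m where "m = (\<Sum>e\<in>{e\<in>F. e \<subseteq> S}. g e)"
    have m: "(\<Sum>e\<in>{e\<in>F. e \<subseteq> S}. ?l e) = real m"
      unfolding m_def of_nat_sum by (intro sum.cong g) auto
    have "(\<Sum>v\<in>S. \<Sum>e\<in>incident_edges F v. ?l e) = (\<Sum>v\<in>S. 2 * real (k v))"
      using S by (intro sum.cong k) auto
    also have "\<dots> = 2 * real (\<Sum>v\<in>S. k v)"
      by (simp add: sum_distrib_left)
    finally have "(\<Sum>v\<in>S. \<Sum>e\<in>incident_edges F v. ?l e) = 2 * real (\<Sum>v\<in>S. k v)" .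
    with sum_degrees_eq[OF G, of S ?l] S m
    have eq: "(\<Sum>e\<in>cut_edges F S. ?l e) = 2 * real (\<Sum>v\<in>S. k v) - 2 * real m"
      by auto
    obtain e where "e \<in> cut_edges F S" "?l e > 0"
      using cut[OF S] by blast
    then have "(\<Sum>e\<in>cut_edges F S. ?l e) > 0"
      using fin nonneg by (intro sum_pos2) (auto simp: cut_edges_def)
    \<comment> \<open>The cut weight is twice a difference of natural numbers; being positive, that
      difference is at least 1.\<close>
    with eq have "(\<Sum>v\<in>S. k v) \<ge> m + 1"
      by linarith
    with eq show ?thesis
      by linarith
  qed
  then show ?thesis
    unfolding gtsp_tour_def
    by (intro conjI ballI allI impI) (simp_all add: t nat pos even)
qed

subsection \<open>Cycles\<close>

text \<open>The index arithmetic for a closed list: \<open>j\<close> is the unique cyclic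
  predecessor of \<open>k\<close>. It is shared by the degree count on a given cycle and by the
  closing argument for a constructed one.\<close>

lemma cyclic_neighbours:
  assumes "distinct vs" "3 \<le> length vs" "k < length vs"
  obtains j where "j < length vs" "Suc j mod length vs = k"
    "vs ! j \<noteq> vs ! (Suc k mod length vs)" "Suc k mod length vs < length vs"
    "\<And>i. i < length vs \<Longrightarrow> Suc i mod length vs = k \<Longrightarrow> i = j"
proof -
  let ?n = "length vs"
  have suc: "Suc i mod ?n = (if Suc i = ?n then 0 else Suc i)" if "i < ?n" for i
    using that by auto
  define j where "j = (if k = 0 then ?n - 1 else k - 1)"
  have j: "j < ?n" "Suc j mod ?n = k"
    using assms unfolding j_def by (auto split: if_splits)
  \<comment> \<open>Predecessor and successor are two apart in cyclic order, so they differ because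
    the length is at least 3.\<close>
  have "j \<noteq> Suc k mod ?n"
    unfolding suc[OF assms(3)] j_def using assms by auto
  moreover have less: "Suc k mod ?n < ?n"
    using assms by (intro mod_less_divisor) auto
  ultimately have ne: "vs ! j \<noteq> vs ! (Suc k mod ?n)"
    using assms j by (simp add: nth_eq_iff_index_eq)
  have uniq: "i = j" if "i < ?n" "Suc i mod ?n = k" for i
    using that suc[of i] suc[OF j(1)] j by (auto split: if_splits)
  show ?thesis
    using that[OF j ne less uniq] .
qed

text \<open>An edge of the cycle contains \<open>v\<close> only as its first or second listed end,
  so it joins \<open>v\<close> to its successor or predecessor, and these two vertices are
  different.\<close>

lemma card_cycle_edges_at:
  assumes "distinct vs" "3 \<le> length vs" "v \<in> set vs"
  shows "card (incident_edges {{vs ! i, vs ! (Suc i mod length vs)} | i. i < length vs} v) = 2"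
proof -
  let ?n = "length vs"
  obtain k where k: "k < ?n" "v = vs ! k"
    using assms by (metis in_set_conv_nth)
  obtain j where j: "j < ?n" "Suc j mod ?n = k" "vs ! j \<noteq> vs ! (Suc k mod ?n)"
    "Suc k mod ?n < ?n" "\<And>i. i < ?n \<Longrightarrow> Suc i mod ?n = k \<Longrightarrow> i = j"
    using cyclic_neighbours[OF assms(1,2) k(1)] by metis
  have "incident_edges {{vs ! i, vs ! (Suc i mod ?n)} | i. i < ?n} v
      = {{vs ! j, v}, {v, vs ! (Suc k mod ?n)}}" (is "?L = ?R")
  proof
    show "?L \<subseteq> ?R"
    proof
      fix e assume "e \<in> ?L"
      then obtain i where i: "i < ?n" "e = {vs ! i, vs ! (Suc i mod ?n)}" "v \<in> e"
        by (auto simp: incident_edges_def)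
      have "Suc i mod ?n < ?n"
        using i by (intro mod_less_divisor) auto
      then have "i = k \<or> Suc i mod ?n = k"
        using i k assms(1) by (auto simp: nth_eq_iff_index_eq)
      then show "e \<in> ?R"
      proof
        assume "i = k"
        with i(2) k(2) show ?thesis by simp
      next
        assume "Suc i mod ?n = k"
        moreover from this have "i = j"
          using j(5) i(1) by blast
        ultimately show ?thesis
          using i(2) k(2) by simp
      qed
    qed
    have edge: "{vs ! i, vs ! (Suc i mod ?n)} \<in> {{vs ! i, vs ! (Suc i mod ?n)} | i. i < ?n}"
      if "i < ?n" for i
      using that by blast
    have "{v, vs ! (Suc k mod ?n)} \<in> ?L"
      using edge[OF k(1)] unfolding incident_edges_def k(2) by simp
    moreover have "{vs ! j, v} \<in> ?L"
      using edge[OF j(1)] unfolding incident_edges_def k(2) j(2) by simp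
    ultimately show "?R \<subseteq> ?L"
      by simp
  qed
  moreover have "{vs ! j, v} \<noteq> {v, vs ! (Suc k mod ?n)}"
    using j(3) by (auto simp: doubleton_eq_iff)
  ultimately show ?thesis
    by simp
qed

text \<open>The edge set of a Hamiltonian cycle, described without an order of the vertices.
  Connectivity is phrased through cuts rather than paths, to match the cut condition on
  tours.\<close>

definition connected_two_factor :: "'v set \<Rightarrow> 'v set set \<Rightarrow> 'v set set \<Rightarrow> bool" where
  "connected_two_factor V E C \<longleftrightarrow> C \<subseteq> E \<and> (\<forall>v\<in>V. card (incident_edges C v) = 2) \<and>
     (\<forall>S. S \<noteq> {} \<and> S \<subset> V \<longrightarrow> (\<exists>e\<in>C. e \<inter> S \<noteq> {} \<and> \<not> e \<subseteq> S))"

text \<open>The edges of the cycle serve as \<open>C\<close>. If none of them left \<open>S\<close>,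
  membership in \<open>S\<close> would propagate along the list, and \<open>S\<close> would contain
  all vertices or none.\<close>

lemma hamiltonian_imp_connected_two_factor:
  assumes "hamiltonian V E"
  obtains C where "connected_two_factor V E C"
proof -
  obtain vs where vs: "graph_cycle V E vs" "\<forall>v\<in>V. count_list vs v = 1"
    using assms by (auto simp: hamiltonian_def)
  let ?n = "length vs"
  let ?C = "{{vs ! i, vs ! (Suc i mod ?n)} | i. i < ?n}"
  have "V \<subseteq> set vs"
    using vs(2) by (metis count_notin subsetI zero_neq_one)
  then have V: "set vs = V" "distinct vs" "3 \<le> ?n" "?C \<subseteq> E"
    using vs(1) by (auto simp: graph_cycle_def)
  have "\<exists>e\<in>?C. e \<inter> S \<noteq> {} \<and> \<not> e \<subseteq> S" if S: "S \<noteq> {}" "S \<subset> V" for S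
  proof (rule ccontr)
    assume no: "\<not> (\<exists>e\<in>?C. e \<inter> S \<noteq> {} \<and> \<not> e \<subseteq> S)"
    have same: "vs ! i \<in> S \<longleftrightarrow> vs ! (Suc i mod ?n) \<in> S" if "i < ?n" for i
    proof -
      have "{vs ! i, vs ! (Suc i mod ?n)} \<in> ?C"
        using that by blast
      then have "\<not> ({vs ! i, vs ! (Suc i mod ?n)} \<inter> S \<noteq> {} \<and>
          \<not> {vs ! i, vs ! (Suc i mod ?n)} \<subseteq> S)"
        using no by blast
      then show ?thesis
        by auto
    qed
    have "vs ! i \<in> S \<longleftrightarrow> vs ! 0 \<in> S" if "i < ?n" for i
      using that
    proof (induction i)
      case (Suc i)
      then show ?case using same[of i] by simp
    qed simp
    then have "\<forall>v\<in>set vs. v \<in> S \<longleftrightarrow> vs ! 0 \<in> S"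
      by (metis in_set_conv_nth)
    then show False
      using S V(1) by blast
  qed
  then have "connected_two_factor V E ?C"
    unfolding connected_two_factor_def
    using V card_cycle_edges_at[OF V(2,3)] by blast
  then show ?thesis
    by (rule that)
qed

text \<open>A longest path in \<open>C\<close> closes up: all neighbours of its first vertex lie on
  it, and the neighbour other than the second vertex can only be the last one. The resulting cycle
  uses up both edges of \<open>C\<close> at each of its vertices, so nothing leaves it, and by
  connectivity it covers \<open>V\<close>.\<close>

lemma connected_two_factor_imp_hamiltonian:
  assumes G: "simple_graph V E" and factor: "connected_two_factor V E C"
  shows "hamiltonian V E"
proof -
  have "C \<subseteq> E" and deg: "\<And>v. v \<in> V \<Longrightarrow> card (incident_edges C v) = 2"
    and conn: "\<And>S. S \<noteq> {} \<Longrightarrow> S \<subset> V \<Longrightarrow> \<exists>e\<in>C. e \<inter> S \<noteq> {} \<and> \<not> e \<subseteq> S"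
    using factor by (auto simp: connected_two_factor_def)
  define N where "N v = {u. {v, u} \<in> C}" for v
  have C: "e \<subseteq> V" "card e = 2" if "e \<in> C" for e
    using G \<open>C \<subseteq> E\<close> that by (auto simp: simple_graph_def)
  have NV: "N v \<subseteq> V" and irrefl: "v \<notin> N v" and sym: "u \<in> N v \<longleftrightarrow> v \<in> N u" for u v
    using C(1)[of "{v, _}"] C(2)[of "{v, v}"] by (auto simp: N_def insert_commute)
  have "finite V" "V \<noteq> {}"
    using G by (auto simp: simple_graph_def)
  have finN: "finite (N v)" for v
    using NV \<open>finite V\<close> finite_subset by blast
  have cardN: "card (N v) = 2" if "v \<in> V" for v
  proof -
    have "incident_edges C v = (\<lambda>u. {v, u}) ` N v"
    proof (intro equalityI subsetI)
      fix e assume "e \<in> incident_edges C v"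
      then have "e \<in> C" "v \<in> e" by (auto simp: incident_edges_def)
      moreover from this obtain u where "e = {v, u}"
        using C(2)[of e] by (auto simp: card_2_iff)
      ultimately show "e \<in> (\<lambda>u. {v, u}) ` N v" by (auto simp: N_def)
    qed (auto simp: N_def incident_edges_def)
    moreover have "inj_on (\<lambda>u. {v, u}) (N v)"
      by (auto simp: inj_on_def doubleton_eq_iff)
    ultimately show ?thesis
      using deg[OF that] by (metis card_image)
  qed
  \<comment> \<open>The paths along \<open>C\<close>; having distinct vertices, they have length at
    most \<open>card V\<close>, so a longest one exists.\<close>
  define P where "P vs \<longleftrightarrow> vs \<noteq> [] \<and> distinct vs \<and> set vs \<subseteq> V \<and>
    (\<forall>i. Suc i < length vs \<longrightarrow> vs ! Suc i \<in> N (vs ! i))" for vs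
  obtain v0 where "v0 \<in> V"
    using \<open>V \<noteq> {}\<close> by blast
  then have "P [v0]"
    by (simp add: P_def)
  moreover have "\<forall>ws. P ws \<longrightarrow> length ws < Suc (card V)"
    using card_mono[OF \<open>finite V\<close>] unfolding P_def by (metis distinct_card le_imp_less_Suc)
  ultimately have "\<exists>vs. P vs \<and> (\<forall>ws. P ws \<longrightarrow> length ws \<le> length vs)"
    by (rule ex_has_greatest_nat[of P _ length])
  then obtain vs where "P vs" and max: "\<And>ws. P ws \<Longrightarrow> length ws \<le> length vs"
    by blast
  let ?n = "length vs"
  from \<open>P vs\<close> have vs: "vs \<noteq> []" "distinct vs" "set vs \<subseteq> V"
    and step: "\<And>i. Suc i < ?n \<Longrightarrow> vs ! Suc i \<in> N (vs ! i)"
    unfolding P_def by blast+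
  \<comment> \<open>A neighbour off the path could be put in front of it, against
    maximality.\<close>
  have nbr: "N (vs ! 0) \<subseteq> set vs"
  proof
    fix u assume u: "u \<in> N (vs ! 0)"
    show "u \<in> set vs"
    proof (rule ccontr)
      assume "u \<notin> set vs"
      moreover have "u \<in> V" using u NV by blast
      ultimately have "P (u # vs)"
        unfolding P_def using vs step u sym by (auto simp: nth_Cons split: nat.split)
      from max[OF this] show False by simp
    qed
  qed
  have "vs ! 0 \<in> V"
    using vs by auto
  \<comment> \<open>If the path has a single vertex, \<open>vs ! 1\<close> is an unspecified value;
    all that matters is that one value cannot account for two neighbours. That case is excluded once
    \<open>j \<ge> 2\<close> is known.\<close>
  have "\<not> N (vs ! 0) \<subseteq> {vs ! 1}"
    using cardN[OF \<open>vs ! 0 \<in> V\<close>] card_mono[of "{vs ! 1}" "N (vs ! 0)"] by auto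
  then obtain b where b: "b \<in> N (vs ! 0)" "b \<noteq> vs ! 1"
    by blast
  with nbr obtain j where j: "j < ?n" "b = vs ! j"
    by (metis in_set_conv_nth subsetD)
  have "j \<noteq> 0"
    using b(1) j(2) irrefl by metis
  moreover have "j \<noteq> 1"
    using b(2) j(2) by metis
  ultimately have "j \<ge> 2" by simp
  \<comment> \<open>Otherwise \<open>b\<close> would have three neighbours: the start of the path,
    its predecessor and its successor. They are distinct because \<open>j \<ge> 2\<close> separates
    index 0 from \<open>j - 1\<close>.\<close>
  have "Suc j = ?n"
  proof (rule ccontr)
    assume "Suc j \<noteq> ?n"
    then have sj: "Suc j < ?n" using j by simp
    have "vs ! j \<in> N (vs ! (j - 1))"
      using step[of "j - 1"] \<open>j \<ge> 2\<close> j by simp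
    then have sub: "{vs ! 0, vs ! (j - 1), vs ! Suc j} \<subseteq> N b"
      using sj step[OF sj] b j sym by auto
    moreover have "card {vs ! 0, vs ! (j - 1), vs ! Suc j} = 3"
    proof -
      have "vs ! i = vs ! k \<longleftrightarrow> i = k" if "i \<le> Suc j" "k \<le> Suc j" for i k
        using that sj by (intro nth_eq_iff_index_eq[OF vs(2)]) auto
      then show ?thesis
        using \<open>j \<ge> 2\<close> by (simp add: card_insert_if)
    qed
    moreover have "card (N b) = 2"
      using cardN b(1) NV by blast
    ultimately show False
      using card_mono[OF finN sub] by simp
  qed
  then have n: "3 \<le> ?n" and "?n - 1 = j"
    using \<open>j \<ge> 2\<close> by auto
  then have closing: "vs ! 0 \<in> N (vs ! (?n - 1))"
    using b(1) j(2) sym by simp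
  have cyc: "vs ! (Suc i mod ?n) \<in> N (vs ! i)" if "i < ?n" for i
  proof (cases "Suc i = ?n")
    case True
    then have "i = ?n - 1" by simp
    with True closing show ?thesis by simp
  next
    case False
    with that step show ?thesis by simp
  qed
  \<comment> \<open>The two cyclic neighbours of \<open>v\<close> already make up the whole of
    \<open>N v\<close>.\<close>
  have closed: "N v \<subseteq> set vs" if v: "v \<in> set vs" for v
  proof -
    obtain k where k: "k < ?n" "v = vs ! k"
      using v by (metis in_set_conv_nth)
    obtain i where i: "i < ?n" "Suc i mod ?n = k" "vs ! i \<noteq> vs ! (Suc k mod ?n)"
      "Suc k mod ?n < ?n"
      using cyclic_neighbours[OF vs(2) n k(1)] by metis
    have "{vs ! i, vs ! (Suc k mod ?n)} \<subseteq> N v"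
      using cyc[OF i(1)] cyc[OF k(1)] i k sym by auto
    moreover have "card {vs ! i, vs ! (Suc k mod ?n)} = card (N v)"
      using i cardN v vs by auto
    ultimately have "{vs ! i, vs ! (Suc k mod ?n)} = N v"
      by (intro card_subset_eq finN)
    moreover have "{vs ! i, vs ! (Suc k mod ?n)} \<subseteq> set vs"
      using i(1,4) by simp
    ultimately show ?thesis
      by simp
  qed
  have "set vs = V"
  proof (rule ccontr)
    assume "set vs \<noteq> V"
    then obtain e where e: "e \<in> C" "e \<inter> set vs \<noteq> {}" "\<not> e \<subseteq> set vs"
      using conn[of "set vs"] vs by auto
    then obtain u v where uv: "u \<in> e" "u \<in> set vs" "v \<in> e" "v \<notin> set vs"
      by blast
    then have "e = {u, v}"
      using C(2)[OF e(1)] by (auto simp: card_2_iff)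
    then have "v \<in> N u"
      using e(1) by (simp add: N_def)
    then show False
      using closed[OF uv(2)] uv(4) by blast
  qed
  moreover have "graph_cycle V E vs"
    unfolding graph_cycle_def using n vs cyc \<open>C \<subseteq> E\<close> by (auto simp: N_def)
  moreover have "count_list vs v = 1" if "v \<in> set vs" for v
    using vs(2) that by (induction vs) (auto simp: count_list_0_iff)
  ultimately show ?thesis
    unfolding hamiltonian_def by blast
qed

subsection \<open>Subdivisions\<close>

abbreviation half_edge :: "'v \<Rightarrow> 'v set \<Rightarrow> ('v + 'v set) set" where
  "half_edge v e \<equiv> {Inl v, Inr e}"

lemma half_edge_eq_iff: "half_edge v e = half_edge u f \<longleftrightarrow> v = u \<and> e = f"
  by (auto simp: doubleton_eq_iff)

lemma simple_graph_subdivision: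
  assumes "simple_graph V E"
  shows "simple_graph (subdivision_verts V E) (subdivision_edges E)"
proof -
  have "h \<subseteq> subdivision_verts V E" "card h = 2" if "h \<in> subdivision_edges E" for h
  proof -
    obtain v e where "e \<in> E" "v \<in> e" "h = {Inl v, Inr e}"
      using \<open>h \<in> _\<close> by (auto simp: subdivision_edges_def)
    then show "h \<subseteq> subdivision_verts V E" "card h = 2"
      using assms by (auto simp: simple_graph_def subdivision_verts_def)
  qed
  moreover have "finite (subdivision_verts V E)" "subdivision_verts V E \<noteq> {}"
    using assms simple_graph_finite_edges[OF assms]
    by (auto simp: simple_graph_def subdivision_verts_def)
  ultimately show ?thesis
    by (simp add: simple_graph_def)
qed

lemma sum_incident_subdivision_Inl:
  fixes f :: "_ \<Rightarrow> real"
  shows "(\<Sum>h\<in>incident_edges (subdivision_edges E) (Inl v). f h)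
    = (\<Sum>e\<in>incident_edges E v. f (half_edge v e))"
proof -
  have "incident_edges (subdivision_edges E) (Inl v) = half_edge v ` incident_edges E v"
    by (auto simp: incident_edges_def subdivision_edges_def)
  moreover have "inj_on (half_edge v) (incident_edges E v)"
    by (auto simp: inj_on_def half_edge_eq_iff)
  ultimately show ?thesis
    by (simp add: sum.reindex)
qed

lemma sum_incident_subdivision_Inr:
  fixes f :: "_ \<Rightarrow> real"
  assumes "e \<in> E"
  shows "(\<Sum>h\<in>incident_edges (subdivision_edges E) (Inr e). f h) = (\<Sum>v\<in>e. f (half_edge v e))"
proof -
  have "incident_edges (subdivision_edges E) (Inr e) = (\<lambda>v. half_edge v e) ` e"
    using assms by (auto simp: incident_edges_def subdivision_edges_def)
  moreover have "inj_on (\<lambda>v. half_edge v e) e"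
    by (auto simp: inj_on_def half_edge_eq_iff)
  ultimately show ?thesis
    by (simp add: sum.reindex)
qed

text \<open>Half-edges correspond bijectively to pairs of an edge and one of its ends. With
  \<open>f\<close> constantly 1 this also counts the half-edges: two for each edge.\<close>

lemma sum_subdivision_edges:
  fixes f :: "_ \<Rightarrow> real"
  assumes "simple_graph V E"
  shows "(\<Sum>h\<in>subdivision_edges E. f h) = (\<Sum>e\<in>E. \<Sum>v\<in>e. f (half_edge v e))"
proof -
  have fin: "finite E" "\<forall>e\<in>E. finite e"
    using assms simple_graph_finite_edges finite_subset by (auto simp: simple_graph_def)
  have "subdivision_edges E = (\<lambda>(e, v). half_edge v e) ` (SIGMA e:E. e)"
    by (auto simp: subdivision_edges_def)
  moreover have "inj_on (\<lambda>(e, v). half_edge v e) (SIGMA e:E. e)"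
    by (auto simp: inj_on_def half_edge_eq_iff)
  ultimately show ?thesis
    using fin by (simp add: sum.reindex sum.Sigma case_prod_unfold)
qed

lemma cut_edges_subdivision_iff:
  assumes "e \<in> E" "v \<in> e"
  shows "half_edge v e \<in> cut_edges (subdivision_edges E) S \<longleftrightarrow> (Inl v \<in> S \<longleftrightarrow> Inr e \<notin> S)"
proof -
  have "half_edge v e \<in> subdivision_edges E"
    using assms by (auto simp: subdivision_edges_def)
  then show ?thesis
    by (auto simp: cut_edges_def Int_insert_left)
qed

lemma lookup_scaleR [simp]:
  "Poly_Mapping.lookup (c *\<^sub>R x) i = c * (Poly_Mapping.lookup x i :: real)"
proof -
  have "finite {i. c *\<^sub>R Poly_Mapping.lookup x i \<noteq> 0}"
    by (rule finite_subset[OF _ finite_lookup[of x]]) auto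
  then show ?thesis
    by (simp add: scaleR_poly_mapping_def)
qed

subsection \<open>From tours to Hamiltonian cycles\<close>

text \<open>If every tour had total weight above \<open>card F\<close>, so would every point of the polytope.\<close>

lemma polytope_all_ones_imp_light_tour:
  assumes "x \<in> gtsp_polytope W F" "\<forall>e\<in>F. Poly_Mapping.lookup x e = 1"
  obtains t where "gtsp_tour W F t" "(\<Sum>e\<in>F. Poly_Mapping.lookup t e) \<le> real (card F)"
proof (rule ccontr)
  assume "\<not> thesis"
  let ?A = "{y. (\<Sum>e\<in>F. Poly_Mapping.lookup y e) > real (card F)}"
  have "convex ?A"
  proof (rule convexI)
    fix y z :: "'a set \<Rightarrow>\<^sub>0 real" and a b :: real
    assume "y \<in> ?A" "z \<in> ?A" "0 \<le> a" "0 \<le> b" "a + b = 1"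
    \<comment> \<open>The signs are flipped because \<open>convex_bound_lt\<close> speaks of strict
      upper bounds.\<close>
    then have "a * (\<Sum>e\<in>F. Poly_Mapping.lookup y e) + b * (\<Sum>e\<in>F. Poly_Mapping.lookup z e)
        > real (card F)"
      using convex_bound_lt[of "- (\<Sum>e\<in>F. Poly_Mapping.lookup y e)" "- real (card F)"
          "- (\<Sum>e\<in>F. Poly_Mapping.lookup z e)" a b] by simp
    then show "a *\<^sub>R y + b *\<^sub>R z \<in> ?A"
      by (simp add: lookup_add sum.distrib sum_distrib_left)
  qed
  moreover have "{t. gtsp_tour W F t} \<subseteq> ?A"
    using that \<open>\<not> thesis\<close> by force
  ultimately have "x \<in> ?A"
    using assms(1) hull_minimal unfolding gtsp_polytope_def by blast
  then show False
    using assms(2) by simp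
qed

text \<open>The weight bound forces degree exactly 2 at every subdivision vertex. The edges with
  weight 1 on both halves then form a connected two-factor: the remaining halves have weight 0 or 2,
  so they neither affect parity nor lead from one end of an edge to the other.\<close>

lemma light_tour_imp_hamiltonian:
  assumes reg: "regular_graph 3 V E"
    and tour: "gtsp_tour (subdivision_verts V E) (subdivision_edges E) t"
    and light: "(\<Sum>h\<in>subdivision_edges E. Poly_Mapping.lookup t h)
      \<le> real (card (subdivision_edges E))"
  shows "hamiltonian V E"
proof -
  define w where "w v e = Poly_Mapping.lookup t (half_edge v e)" for v e
  let ?F = "subdivision_edges E"
  have G: "simple_graph V E" and cubic: "\<And>v. v \<in> V \<Longrightarrow> card (incident_edges E v) = 3"
    using reg by (auto simp: regular_graph_def)
  have finE: "finite E"
    using G simple_graph_finite_edges by blast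
  have E: "e \<subseteq> V" "card e = 2" "finite e" if "e \<in> E" for e
    using G that card.infinite by (fastforce simp: simple_graph_def)+
  have w_nat: "w v e \<in> \<nat>" if "e \<in> E" "v \<in> e" for v e
  proof -
    have "half_edge v e \<in> ?F"
      using that by (auto simp: subdivision_edges_def)
    then show ?thesis
      using tour unfolding gtsp_tour_def w_def by blast
  qed
  have w_even: "\<exists>k::nat. (\<Sum>e\<in>incident_edges E v. w v e) = 2 * real k" if "v \<in> V" for v
  proof -
    have "Inl v \<in> subdivision_verts V E"
      using that by (simp add: subdivision_verts_def)
    with tour show ?thesis
      unfolding gtsp_tour_def w_def sum_incident_subdivision_Inl[symmetric] by blast
  qed
  have ge2: "(\<Sum>v\<in>e. w v e) \<ge> 2" if e: "e \<in> E" for e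
  proof -
    have "Inr e \<in> subdivision_verts V E"
      using e by (simp add: subdivision_verts_def)
    with tour obtain k :: nat where "(\<Sum>v\<in>e. w v e) > 0" "(\<Sum>v\<in>e. w v e) = 2 * real k"
      unfolding gtsp_tour_def w_def sum_incident_subdivision_Inr[OF e, symmetric] by blast
    then show ?thesis by simp
  qed
  \<comment> \<open>There are \<open>2 * card E\<close> half-edges, so lightness bounds the total
    excess of the subdivision vertices over degree 2; each single excess is nonnegative by
    \<open>ge2\<close>.\<close>
  have "(\<Sum>e\<in>E. (\<Sum>v\<in>e. w v e) - 2) \<le> 0"
    using light sum_subdivision_edges[OF G, of "\<lambda>_. 1"] E(2)
    by (simp add: sum_subdivision_edges[OF G] sum_subtractf flip: w_def)
  moreover have "(\<Sum>e\<in>E. (\<Sum>v\<in>e. w v e) - 2) \<ge> 0"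
    using ge2 by (intro sum_nonneg) simp
  ultimately have "(\<Sum>e\<in>E. (\<Sum>v\<in>e. w v e) - 2) = 0"
    by simp
  then have eq2: "(\<Sum>v\<in>e. w v e) = 2" if "e \<in> E" for e
    using that finE ge2 by (subst (asm) sum_nonneg_eq_0_iff) auto
  define C where "C = {e \<in> E. \<forall>v\<in>e. w v e = 1}"
  have pair: "w u e + w v e = 2" if "e \<in> E" "u \<in> e" "v \<in> e" "u \<noteq> v" for u v e
  proof -
    have "e = {u, v}"
      using E(2)[OF that(1)] that by (auto simp: card_2_iff)
    then show ?thesis
      using eq2[OF that(1)] that(4) by simp
  qed
  \<comment> \<open>Two natural numbers with sum 2 are (1, 1), (2, 0) or (0, 2). Written this way,
    the weight is the indicator of \<open>C\<close> modulo 2.\<close>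
  have w_cases: "w v e = (if e \<in> C then 1 else 0) + 2 * (if w v e = 2 then 1 else 0)"
    if ve: "e \<in> E" "v \<in> e" for v e
  proof -
    obtain u where u: "u \<in> e" "u \<noteq> v" "e = {u, v}"
    proof -
      obtain a b where "e = {a, b}" "a \<noteq> b"
        using E(2)[OF ve(1)] by (auto simp: card_2_iff)
      then show thesis
        using that[of a] that[of b] ve(2) by (cases "v = a") auto
    qed
    obtain a b :: nat where "w v e = real a" "w u e = real b"
      using w_nat[OF ve] w_nat[OF ve(1) u(1)] by (auto simp: Nats_def)
    moreover from this have "a + b = 2"
      using pair[OF ve(1) u(1) ve(2) u(2)] by linarith
    moreover from this have "a = 0 \<or> a = 1 \<or> a = 2"
      by auto
    moreover have "e \<in> C \<longleftrightarrow> w u e = 1 \<and> w v e = 1"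
      using ve(1) u(3) unfolding C_def by blast
    ultimately show ?thesis
      by auto
  qed
  have conn: "\<exists>e\<in>C. e \<inter> S \<noteq> {} \<and> \<not> e \<subseteq> S" if S: "S \<noteq> {}" "S \<subset> V" for S
  proof (rule ccontr)
    assume no: "\<not> (\<exists>e\<in>C. e \<inter> S \<noteq> {} \<and> \<not> e \<subseteq> S)"
    \<comment> \<open>\<open>S\<close> together with every middle vertex that the tour reaches
      directly from \<open>S\<close>. A half of positive weight can cross this cut only at an end
      outside \<open>S\<close> whose opposite half, with its end in \<open>S\<close>, is positive
      too.\<close>
    define T where "T = Inl ` S \<union> Inr ` {e \<in> E. \<exists>v\<in>e \<inter> S. w v e > 0}"
    have "T \<noteq> {}" "T \<subset> subdivision_verts V E"
      using S by (auto simp: T_def subdivision_verts_def)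
    then have "(\<Sum>h\<in>cut_edges ?F T. Poly_Mapping.lookup t h) \<ge> 2"
      using tour unfolding gtsp_tour_def by blast
    then obtain h where h: "h \<in> cut_edges ?F T" "Poly_Mapping.lookup t h \<noteq> 0"
      by (metis (mono_tags, lifting) not_numeral_le_zero sum.neutral)
    then obtain v e where ve: "e \<in> E" "v \<in> e" "h = half_edge v e"
      by (auto simp: cut_edges_def subdivision_edges_def)
    have "w v e > 0"
      using h(2) ve w_nat[OF ve(1,2)] by (auto simp: w_def Nats_def)
    have cross: "v \<in> S \<longleftrightarrow> \<not> (\<exists>u\<in>e \<inter> S. w u e > 0)"
      using h(1) ve cut_edges_subdivision_iff[OF ve(1,2)] by (auto simp: T_def)
    with \<open>w v e > 0\<close> ve have "v \<notin> S"
      by blast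
    with cross obtain u where u: "u \<in> e" "u \<in> S" "w u e > 0"
      by blast
    have "e \<notin> C"
      using no u ve \<open>v \<notin> S\<close> by blast
    \<comment> \<open>Positive weights off \<open>C\<close> must equal 2, but the two halves of
      \<open>e\<close> only sum to 2.\<close>
    then have "w u e = 2" "w v e = 2"
      using w_cases[OF ve(1,2)] w_cases[OF ve(1) u(1)] u(3) \<open>w v e > 0\<close>
      by (auto split: if_splits)
    moreover have "w u e + w v e = 2"
      using pair[OF ve(1) u(1) ve(2)] u(2) \<open>v \<notin> S\<close> by blast
    ultimately show False
      by simp
  qed
  have "card (incident_edges C v) = 2" if v: "v \<in> V" for v
  proof -
    have inc: "finite (incident_edges E v)" "incident_edges C v \<subseteq> incident_edges E v"
      using finE by (auto simp: incident_edges_def C_def)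
    obtain k :: nat where k: "(\<Sum>e\<in>incident_edges E v. w v e) = 2 * real k"
      using w_even[OF v] by blast
    have "(\<Sum>e\<in>incident_edges E v. w v e) =
        (\<Sum>e\<in>incident_edges E v. (if e \<in> C then 1 else 0) + 2 * (if w v e = 2 then 1 else 0))"
      by (intro sum.cong w_cases) (auto simp: incident_edges_def)
    also have "\<dots> = real (card {e \<in> incident_edges E v. e \<in> C})
        + 2 * real (card {e \<in> incident_edges E v. w v e = 2})"
      using inc by (simp add: sum.distrib real_card_filter flip: sum_distrib_left)
    also have "{e \<in> incident_edges E v. e \<in> C} = incident_edges C v"
      by (auto simp: incident_edges_def C_def)
    finally have "real (card (incident_edges C v)
        + 2 * card {e \<in> incident_edges E v. w v e = 2}) = real (2 * k)"
      using k by simp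
    then have "card (incident_edges C v) + 2 * card {e \<in> incident_edges E v. w v e = 2} = 2 * k"
      by (simp only: of_nat_eq_iff)
    \<comment> \<open>An even number that is at most 3 and nonzero is 2: this is where cubicity
      enters, with connectivity at \<open>{v}\<close> excluding 0.\<close>
    then have "even (card (incident_edges C v))"
      by presburger
    moreover have "card (incident_edges C v) \<le> 3"
      using cubic[OF v] card_mono[OF inc] by simp
    moreover have "incident_edges C v \<noteq> {}"
    proof -
      have "incident_edges E v \<noteq> {}"
        using cubic[OF v] by auto
      then obtain e where "e \<in> E" "v \<in> e"
        by (auto simp: incident_edges_def)
      then have "V \<noteq> {v}"
        using E[of e] card_mono[of "{v}" e] by auto
      then have "{v} \<subset> V"
        using v by auto
      then show ?thesis
        using conn[of "{v}"] by (auto simp: incident_edges_def)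
    qed
    then have "card (incident_edges C v) \<noteq> 0"
      using inc finite_subset by fastforce
    ultimately show ?thesis
      by presburger
  qed
  then have "connected_two_factor V E C"
    unfolding connected_two_factor_def using conn by (auto simp: C_def)
  with G show ?thesis
    by (rule connected_two_factor_imp_hamiltonian)
qed

subsection \<open>From Hamiltonian cycles to tours\<close>

text \<open>The tour runs along \<open>C\<close> and visits the middle vertex of every other edge
  \<open>e\<close> by going back and forth from \<open>p e\<close>. Each such detour adds 2 to the
  degree of \<open>p e\<close>. The choice \<open>p\<close> is left free so that opposite choices
  can be averaged.\<close>

lemma pendant_tour:
  assumes G: "simple_graph V E" and factor: "connected_two_factor V E C"
    and p: "\<And>e. e \<in> E \<Longrightarrow> p e \<in> e"
  obtains t where "gtsp_tour (subdivision_verts V E) (subdivision_edges E) t"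
    "\<And>v e. e \<in> E \<Longrightarrow> v \<in> e \<Longrightarrow>
      Poly_Mapping.lookup t (half_edge v e) = (if e \<in> C then 1 else if v = p e then 2 else 0)"
proof -
  let ?F = "subdivision_edges E"
  have "C \<subseteq> E" and deg: "\<And>v. v \<in> V \<Longrightarrow> card (incident_edges C v) = 2"
    and conn: "\<And>S. S \<noteq> {} \<Longrightarrow> S \<subset> V \<Longrightarrow> \<exists>e\<in>C. e \<inter> S \<noteq> {} \<and> \<not> e \<subseteq> S"
    using factor by (auto simp: connected_two_factor_def)
  have finE: "finite E"
    using G simple_graph_finite_edges by blast
  have E: "e \<subseteq> V" "card e = 2" "finite e" if "e \<in> E" for e
    using G that card.infinite by (fastforce simp: simple_graph_def)+
  \<comment> \<open>A half-edge contains just one \<open>Inr e\<close>, which identifies its edge.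
    The value 0 outside \<open>?F\<close> makes the support finite and puts \<open>t\<close> into
    \<open>edge_vectors ?F\<close>.\<close>
  define f :: "('a + 'a set) set \<Rightarrow> real" where
    "f h = (if h \<notin> ?F then 0 else if \<exists>e\<in>C. Inr e \<in> h then 1
      else if \<exists>e. h = half_edge (p e) e then 2 else 0)" for h
  define t where "t = Abs_poly_mapping f"
  have "finite ?F"
    using simple_graph_finite_edges[OF simple_graph_subdivision[OF G]] .
  then have "finite {h. f h \<noteq> 0}"
    by (rule rev_finite_subset) (auto simp: f_def)
  then have lookup_t: "Poly_Mapping.lookup t = f"
    by (simp add: t_def)
  have f: "f (half_edge v e) = (if e \<in> C then 1 else if v = p e then 2 else 0)"
    if "e \<in> E" "v \<in> e" for v e
    using that by (auto simp: f_def subdivision_edges_def half_edge_eq_iff)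
  have deg_Inl: "(\<Sum>h\<in>incident_edges ?F (Inl v). f h)
      = 2 * real (1 + card {e \<in> incident_edges E v - C. v = p e})" if "v \<in> V" for v
  proof -
    have fin: "finite (incident_edges E v)"
      using finE by (simp add: incident_edges_def)
    have "(\<Sum>h\<in>incident_edges ?F (Inl v). f h)
        = (\<Sum>e\<in>incident_edges E v. if e \<in> C then 1 else if v = p e then 2 else 0)"
      unfolding sum_incident_subdivision_Inl
      by (intro sum.cong f) (auto simp: incident_edges_def)
    also have "\<dots> = (\<Sum>e\<in>incident_edges E v. (if e \<in> C then 1 else 0)
        + 2 * (if e \<notin> C \<and> v = p e then 1 else 0))"
      by (intro sum.cong) auto
    also have "\<dots> = real (card {e \<in> incident_edges E v. e \<in> C})
        + 2 * real (card {e \<in> incident_edges E v. e \<notin> C \<and> v = p e})"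
      using fin by (simp add: sum.distrib real_card_filter flip: sum_distrib_left)
    also have "{e \<in> incident_edges E v. e \<in> C} = incident_edges C v"
      using \<open>C \<subseteq> E\<close> by (auto simp: incident_edges_def)
    also have "{e \<in> incident_edges E v. e \<notin> C \<and> v = p e} = {e \<in> incident_edges E v - C. v = p e}"
      by auto
    finally show ?thesis
      using deg[OF that] by simp
  qed
  have deg_Inr: "(\<Sum>h\<in>incident_edges ?F (Inr e). f h) = 2" if "e \<in> E" for e
  proof -
    have "(\<Sum>h\<in>incident_edges ?F (Inr e). f h)
        = (\<Sum>v\<in>e. if e \<in> C then 1 else if v = p e then 2 else 0)"
      unfolding sum_incident_subdivision_Inr[OF that] by (intro sum.cong f that) auto
    then show ?thesis
      using E[OF that] p[OF that] by (cases "e \<in> C") simp_all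
  qed
  have "gtsp_tour (subdivision_verts V E) ?F t"
  proof (rule gtsp_tourI[OF simple_graph_subdivision[OF G]])
    show "t \<in> edge_vectors ?F"
      by (auto simp: edge_vectors_def in_keys_iff lookup_t f_def split: if_splits)
    show "Poly_Mapping.lookup t h \<in> \<nat>" for h
      by (auto simp: lookup_t f_def)
    show "(\<Sum>h\<in>incident_edges ?F v. Poly_Mapping.lookup t h) > 0"
      and "\<exists>k::nat. (\<Sum>h\<in>incident_edges ?F v. Poly_Mapping.lookup t h) = 2 * real k"
      if "v \<in> subdivision_verts V E" for v
    proof -
      \<comment> \<open>The form \<open>2 * (1 + k)\<close> yields positivity and evenness
        together.\<close>
      have "\<exists>k::nat. (\<Sum>h\<in>incident_edges ?F v. f h) = 2 * real (1 + k)"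
        using that
      proof (cases v)
        case (Inl u)
        with that have "u \<in> V" by (auto simp: subdivision_verts_def)
        from deg_Inl[OF this] Inl show ?thesis by blast
      next
        case (Inr e)
        with that have "e \<in> E" by (auto simp: subdivision_verts_def)
        from deg_Inr[OF this] Inr show ?thesis by (intro exI[of _ 0]) simp
      qed
      then obtain k :: nat where "(\<Sum>h\<in>incident_edges ?F v. f h) = 2 * real (1 + k)"
        by blast
      then show "(\<Sum>h\<in>incident_edges ?F v. Poly_Mapping.lookup t h) > 0"
        and "\<exists>k::nat. (\<Sum>h\<in>incident_edges ?F v. Poly_Mapping.lookup t h) = 2 * real k"
        unfolding lookup_t by (simp, blast)
    qed
    show "\<exists>h\<in>cut_edges ?F S. Poly_Mapping.lookup t h > 0"
      if S: "S \<noteq> {}" "S \<subset> subdivision_verts V E" for S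
    proof (rule ccontr)
      assume no: "\<not> (\<exists>h\<in>cut_edges ?F S. Poly_Mapping.lookup t h > 0)"
      \<comment> \<open>Exactly these halves have positive weight, and none of them crosses
        \<open>S\<close>. Hence no edge of \<open>C\<close> separates the original vertices in
        \<open>S\<close> from the others, and each middle vertex lies on the side of
        \<open>p e\<close>, so \<open>S\<close> is empty or everything.\<close>
      have same: "Inl v \<in> S \<longleftrightarrow> Inr e \<in> S" if "e \<in> E" "v \<in> e" "e \<in> C \<or> v = p e" for v e
      proof -
        have "f (half_edge v e) > 0"
          using f[OF that(1,2)] that(3) by auto
        then show ?thesis
          using no cut_edges_subdivision_iff[OF that(1,2)] by (auto simp: lookup_t)
      qed
      define A where "A = {v \<in> V. Inl v \<in> S}"
      have "\<not> (\<exists>e\<in>C. e \<inter> A \<noteq> {} \<and> \<not> e \<subseteq> A)"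
        using same \<open>C \<subseteq> E\<close> E(1) unfolding A_def by blast
      then have "A = {} \<or> A = V"
        using conn[of A] unfolding A_def by blast
      moreover have "Inr e \<in> S \<longleftrightarrow> p e \<in> A" "p e \<in> V" if "e \<in> E" for e
        using same[OF that p[OF that]] E(1)[OF that] p[OF that] by (auto simp: A_def)
      ultimately show False
        using S unfolding A_def subdivision_verts_def by blast
    qed
  qed
  then show ?thesis
    using that f lookup_t by simp
qed

lemma hamiltonian_imp_all_ones_in_polytope:
  assumes G: "simple_graph V E" and ham: "hamiltonian V E"
    and x: "x \<in> edge_vectors (subdivision_edges E)"
      "\<forall>e\<in>subdivision_edges E. Poly_Mapping.lookup x e = 1"
  shows "x \<in> gtsp_polytope (subdivision_verts V E) (subdivision_edges E)"
proof -
  let ?F = "subdivision_edges E"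
  obtain C where C: "connected_two_factor V E C"
    using ham by (rule hamiltonian_imp_connected_two_factor)
  have "\<forall>e\<in>E. \<exists>a b. e = {a, b} \<and> a \<noteq> b"
    using G by (auto simp: simple_graph_def card_2_iff)
  then obtain p q where pq: "\<And>e. e \<in> E \<Longrightarrow> e = {p e, q e} \<and> p e \<noteq> q e"
    by metis
  obtain s where s: "gtsp_tour (subdivision_verts V E) ?F s"
    "\<And>v e. e \<in> E \<Longrightarrow> v \<in> e \<Longrightarrow>
      Poly_Mapping.lookup s (half_edge v e) = (if e \<in> C then 1 else if v = p e then 2 else 0)"
    using pendant_tour[OF G C, of p] pq by blast
  obtain t where t: "gtsp_tour (subdivision_verts V E) ?F t"
    "\<And>v e. e \<in> E \<Longrightarrow> v \<in> e \<Longrightarrow>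
      Poly_Mapping.lookup t (half_edge v e) = (if e \<in> C then 1 else if v = q e then 2 else 0)"
    using pendant_tour[OF G C, of q] pq by blast
  have "Poly_Mapping.lookup x h = Poly_Mapping.lookup ((1/2) *\<^sub>R s + (1/2) *\<^sub>R t) h" for h
  proof (cases "h \<in> ?F")
    case True
    then obtain v e where ve: "e \<in> E" "v \<in> e" "h = half_edge v e"
      by (auto simp: subdivision_edges_def)
    \<comment> \<open>Off \<open>C\<close>, exactly one of the two tours doubles the half at
      \<open>v\<close> and the other gives it 0; on \<open>C\<close> both give 1. The sum is 2
      either way.\<close>
    have "v = p e \<and> v \<noteq> q e \<or> v = q e \<and> v \<noteq> p e"
      using pq[OF ve(1)] ve(2) by (metis insert_iff singletonD)
    then have "Poly_Mapping.lookup s h + Poly_Mapping.lookup t h = 2"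
      unfolding ve(3) s(2)[OF ve(1,2)] t(2)[OF ve(1,2)] by auto
    with True x(2) show ?thesis
      by (simp add: lookup_add)
  next
    case False
    have "s \<in> edge_vectors ?F" "t \<in> edge_vectors ?F"
      using s(1) t(1) by (auto simp: gtsp_tour_def)
    with x(1) False have "Poly_Mapping.lookup x h = 0" "Poly_Mapping.lookup s h = 0"
      "Poly_Mapping.lookup t h = 0"
      by (auto simp: edge_vectors_def in_keys_iff)
    then show ?thesis
      by (simp add: lookup_add)
  qed
  then have "x = (1/2) *\<^sub>R s + (1/2) *\<^sub>R t"
    by (intro poly_mapping_eqI)
  also have "\<dots> \<in> gtsp_polytope (subdivision_verts V E) ?F"
    unfolding gtsp_polytope_def using s(1) t(1)
    by (intro convexD[OF convex_convex_hull] hull_inc) auto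
  finally show ?thesis .
qed

theorem theorem3:
  fixes V :: "'a set" and E :: "'a set set"
    and x :: "('a + 'a set) set \<Rightarrow>\<^sub>0 real"
  assumes "regular_graph 3 V E"
    and "x \<in> edge_vectors (subdivision_edges E)"
    and "\<forall>e\<in>subdivision_edges E. Poly_Mapping.lookup x e = 1"
  shows "x \<in> gtsp_polytope (subdivision_verts V E) (subdivision_edges E) \<longleftrightarrow> hamiltonian V E"
proof
  assume "x \<in> gtsp_polytope (subdivision_verts V E) (subdivision_edges E)"
  then obtain t where "gtsp_tour (subdivision_verts V E) (subdivision_edges E) t"
    "(\<Sum>e\<in>subdivision_edges E. Poly_Mapping.lookup t e) \<le> real (card (subdivision_edges E))"
    using assms(3) polytope_all_ones_imp_light_tour by blast
  with assms(1) show "hamiltonian V E"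
    by (rule light_tour_imp_hamiltonian)
next
  assume "hamiltonian V E"
  then show "x \<in> gtsp_polytope (subdivision_verts V E) (subdivision_edges E)"
    using assms hamiltonian_imp_all_ones_in_polytope unfolding regular_graph_def by blast
qed

end
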